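(* Let $q$ be a prime power and $n$ a positive integer. The poset $(\mathcal{M}_q(n),\subseteq)$ of all multispaces over $\mathbb{F}_q^n$, ordered by multiset inclusion, is a graded modular lattice.
   Context: A multiset $M$ over a universe $U$ is given by a multiplicity function $\mu_M\colon U\to\{0,1,2,\ldots\}$; $M_1\subseteq M_2$ means $\mu_{M_1}\leqslant\mu_{M_2}$ pointwise. For a finite multiset $B=\{\!\{b_1,\ldots,b_m\}\!\}$ over $\mathbb{F}_q^n$ (the $b_i$ are not necessarily distinct), the multispan $\operatorname{mspan}_q(B)$ is the multiset over $\mathbb{F}_q^n$ in which the multiplicity of $v$ is the number of $m$-tuples $(\alpha_1,\ldots,\alpha_m)\in\mathbb{F}_q^m$ with $\sum_{i=1}^m\alpha_i b_i=v$; if $B$ is empty, $\operatorname{mspan}_q(B)=\{0\}$ (with $0$ of multiplicity $1$). A multiset $W$ over $\mathbb{F}_q^n$ is a multispace over $\mathbb{F}_q^n$ if $W=\operatorname{mspan}_q(B)$ for some multiset $B$; $\mathcal{M}_q(n)$ denotes the collection of all multispaces over $\mathbb{F}_q^n$. A poset $(P,\preceq)$ is a lattice if every two elements $x,y$ have a greatest lower bound $x\land y$ and a least upper bound $x\lor y$. A lattice is graded if there is a function $r\colon P\to\mathbb{Z}$ such that $r(y)=r(x)+1$ whenever $y$ covers $x$ (i.e., $x\prec y$ and there is no $z$ with $x\prec z\prec y$). A lattice is modular if $x\prec y$ implies $x\lor(z\land y)=(x\lor z)\land y$ for all $z$. *)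

theory Defs
  imports "HOL-Analysis.Analysis" "HOL-Library.Multiset" "HOL-Algebra.Lattice"
begin

section \<open>Multispans and multispaces\<close>

text \<open>
  The field with q elements is a type \<open>'a\<close> of class \<open>field\<close> and \<open>finite\<close>, with \<open>q = CARD('a)\<close>,
  and the vector space of dimension \<open>n = CARD('n)\<close> over it is \<open>'a ^ 'n\<close>.  In \<open>mspan\<close>, the multiset \<open>B\<close> is
  enumerated by a list to give meaning to the tuples of coefficients; lemma \<open>count_mspan\<close> shows
  that every enumeration gives the same multispan.
\<close>

definition mspan :: "('a::{field,finite} ^ 'n) multiset \<Rightarrow> ('a ^ 'n) multiset" where
  "mspan B = (let bs = (SOME bs. mset bs = B) in
     {# (\<Sum>i<length bs. (\<alpha> ! i) *s (bs ! i)). \<alpha> \<in># mset_set {\<alpha>. length \<alpha> = length bs} #})"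

lemma finite_tuples: "finite {\<alpha> :: 'a::finite list. length \<alpha> = m}"
  using finite_lists_length_eq[of "UNIV :: 'a set" m] by simp

lemma card_tuples_cong:
  fixes bs cs :: "('a::{field,finite} ^ 'n) list"
  assumes "mset bs = mset cs"
  shows "card {\<alpha>. length \<alpha> = length bs \<and> (\<Sum>i<length bs. (\<alpha> ! i) *s (bs ! i)) = v}
       = card {\<alpha>. length \<alpha> = length cs \<and> (\<Sum>i<length cs. (\<alpha> ! i) *s (cs ! i)) = v}"
proof -
  obtain p where p: "p permutes {..<length cs}" and bs: "permute_list p cs = bs"
    using mset_eq_permutation[OF assms] by blast
  have len: "length bs = length cs" using bs by auto
  have q: "inv p permutes {..<length cs}" using p by (rule permutes_inv)
  have sum_perm: "(\<Sum>i<length cs. (permute_list p \<beta> ! i) *s (bs ! i))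
      = (\<Sum>i<length cs. (\<beta> ! i) *s (cs ! i))" if "length \<beta> = length cs" for \<beta> :: "'a list"
  proof -
    have "(\<Sum>i<length cs. (permute_list p \<beta> ! i) *s (bs ! i))
        = (\<Sum>i<length cs. (\<beta> ! p i) *s (cs ! p i))"
      using that p unfolding bs[symmetric]
      by (intro sum.cong) (auto simp: permute_list_nth)
    also have "\<dots> = (\<Sum>i<length cs. (\<beta> ! i) *s (cs ! i))"
      using sum.permute[OF p, of "\<lambda>i. (\<beta> ! i) *s (cs ! i)"] by (simp add: o_def)
    finally show ?thesis .
  qed
  have inv1: "permute_list (inv p) (permute_list p \<beta>) = \<beta>"
    and inv2: "permute_list p (permute_list (inv p) \<beta>) = \<beta>"
    if "length \<beta> = length cs" for \<beta> :: "'a list"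
    using that p q permutes_inv_o[OF p]
    by (simp_all flip: permute_list_compose)
  have "bij_betw (permute_list p)
     {\<alpha>. length \<alpha> = length cs \<and> (\<Sum>i<length cs. (\<alpha> ! i) *s (cs ! i)) = v}
     {\<alpha>. length \<alpha> = length bs \<and> (\<Sum>i<length bs. (\<alpha> ! i) *s (bs ! i)) = v}"
  proof (rule bij_betw_byWitness[where f' = "permute_list (inv p)"], goal_cases)
    case 4
    show ?case
    proof clarsimp
      fix \<alpha> :: "'a list"
      assume *: "length \<alpha> = length bs"
      show "length bs = length cs \<and> (\<Sum>i<length cs. (permute_list (inv p) \<alpha> ! i) *s (cs ! i))
         = (\<Sum>i<length bs. (\<alpha> ! i) *s (bs ! i))"
        using sum_perm[of "permute_list (inv p) \<alpha>"] inv2[of \<alpha>] * len by simp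
    qed
  qed (use inv1 inv2 sum_perm len in auto)
  then show ?thesis by (metis (no_types, lifting) bij_betw_same_card)
qed

lemma count_mspan:
  fixes bs :: "('a::{field,finite} ^ 'n) list"
  shows "count (mspan (mset bs)) v
       = card {\<alpha>. length \<alpha> = length bs \<and> (\<Sum>i<length bs. (\<alpha> ! i) *s (bs ! i)) = v}"
proof -
  define cs where "cs = (SOME cs. mset cs = mset bs)"
  have cs: "mset cs = mset bs"
    unfolding cs_def by (rule someI) (rule refl)
  have "count (mspan (mset bs)) v
      = card {\<alpha>. length \<alpha> = length cs \<and> (\<Sum>i<length cs. (\<alpha> ! i) *s (cs ! i)) = v}"
    unfolding mspan_def cs_def[symmetric] Let_def
    by (simp add: count_image_mset' finite_tuples sum.If_cases flip: card_eq_sum)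
       (auto intro!: arg_cong[where f = card] simp: finite_tuples)
  also have "\<dots> = card {\<alpha>. length \<alpha> = length bs \<and> (\<Sum>i<length bs. (\<alpha> ! i) *s (bs ! i)) = v}"
    by (rule card_tuples_cong[OF cs])
  finally show ?thesis .
qed

lemma mspan_empty: "mspan {#} = {#0#}"
  by (simp add: mspan_def)

definition multispaces :: "('a::{field,finite} ^ 'n) multiset set" where
  "multispaces = {W. \<exists>B. W = mspan B}"

definition multispace_poset :: "('a::{field,finite} ^ 'n) multiset gorder" where
  "multispace_poset = \<lparr>carrier = multispaces, eq = (=), le = (\<subseteq>#)\<rparr>"


section \<open>Graded and modular lattices\<close>

text \<open>\<open>covers L y x\<close> states that \<open>y\<close> covers \<open>x\<close>.\<close>

definition covers :: "('a, 'b) gorder_scheme \<Rightarrow> 'a \<Rightarrow> 'a \<Rightarrow> bool" where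
  "covers L y x \<longleftrightarrow> x \<sqsubset>\<^bsub>L\<^esub> y \<and> \<not> (\<exists>z \<in> carrier L. x \<sqsubset>\<^bsub>L\<^esub> z \<and> z \<sqsubset>\<^bsub>L\<^esub> y)"

locale graded_lattice = Lattice.lattice L for L (structure) +
  assumes graded: "\<exists>r :: 'a \<Rightarrow> int.
    \<forall>x \<in> carrier L. \<forall>y \<in> carrier L. covers L y x \<longrightarrow> r y = r x + 1"

locale modular_lattice = Lattice.lattice L for L (structure) +
  assumes modular: "\<lbrakk>x \<in> carrier L; y \<in> carrier L; z \<in> carrier L; x \<sqsubset> y\<rbrakk>
    \<Longrightarrow> x \<squnion> (z \<sqinter> y) = (x \<squnion> z) \<sqinter> y"

end

theory Submission
  imports Defs
begin

text \<open>
  Every multispace consists of the vectors of a subspace \<open>V\<close>, all with the same multiplicity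
  \<open>q ^ t\<close>: appending a generator from \<open>V\<close> raises \<open>t\<close> by one, appending one outside \<open>V\<close> enlarges \<open>V\<close>
  and keeps \<open>t\<close>.  All pairs \<open>(V, t)\<close> occur, and inclusion of multispaces is the componentwise order
  on pairs.  So the poset is the product of the subspace lattice and the chain of natural numbers;
  it is modular because both factors are, and it is graded by \<open>dim V + t\<close>.
\<close>

section \<open>Uniform multisets on subspaces and their inclusion order\<close>

definition uniform_mspace :: "('a::{field,finite} ^ 'n::finite) set \<Rightarrow> nat \<Rightarrow> ('a ^ 'n) multiset" where
  "uniform_mspace V t = repeat_mset (CARD('a) ^ t) (mset_set V)"

lemma card_field_gt_1: "1 < CARD('a::{field,finite})"
proof -
  have "card {0, 1 :: 'a} \<le> CARD('a)"
    by (rule card_mono) auto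
  then show ?thesis by simp
qed

lemma count_uniform_mspace:
  fixes V :: "('a::{field,finite} ^ 'n::finite) set"
  shows "count (uniform_mspace V t) v = (if v \<in> V then CARD('a) ^ t else 0)"
  by (simp add: uniform_mspace_def)

lemma set_uniform_mspace: "set_mset (uniform_mspace V t) = V"
  by (auto simp: set_mset_def count_uniform_mspace)

text \<open>Supports compare the subspaces. The multiplicity of 0, which lies in \<open>V\<close>,
  compares the exponents, because powers of \<open>CARD('a)\<close> > 1 are strictly
  increasing.\<close>

lemma uniform_mspace_subseteq_iff:
  fixes V W :: "('a::{field,finite} ^ 'n::finite) set"
  assumes "vec.subspace V"
  shows "uniform_mspace V s \<subseteq># uniform_mspace W t \<longleftrightarrow> V \<subseteq> W \<and> s \<le> t"
proof
  assume le: "uniform_mspace V s \<subseteq># uniform_mspace W t"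
  have sub: "V \<subseteq> W"
    using set_mset_mono[OF le] by (simp add: set_uniform_mspace)
  have "0 \<in> V" using assms by (rule vec.subspace_0)
  then have "CARD('a) ^ s \<le> CARD('a) ^ t"
    using mset_subset_eq_count[OF le, of 0] sub by (auto simp: count_uniform_mspace)
  with sub show "V \<subseteq> W \<and> s \<le> t"
    using card_field_gt_1[where 'a = 'a] by (simp add: power_increasing_iff)
next
  assume "V \<subseteq> W \<and> s \<le> t"
  then show "uniform_mspace V s \<subseteq># uniform_mspace W t"
    by (auto simp: subseteq_mset_def count_uniform_mspace power_increasing_iff
        card_field_gt_1[where 'a = 'a, simplified])
qed

lemma uniform_mspace_eq_iff:
  assumes "vec.subspace V" "vec.subspace W"
  shows "uniform_mspace V s = uniform_mspace W t \<longleftrightarrow> V = W \<and> s = t"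
  using uniform_mspace_subseteq_iff[OF assms(1), of s W t]
    uniform_mspace_subseteq_iff[OF assms(2), of t V s] by auto

section \<open>Multispans are exactly the uniform multisets on subspaces\<close>

lemma count_mspan_add:
  fixes b :: "'a::{field,finite} ^ 'n::finite"
  shows "count (mspan (add_mset b B)) v = (\<Sum>c\<in>UNIV. count (mspan B) (v - c *s b))"
proof -
  obtain bs where bs: "mset bs = B" using ex_mset by blast
  let ?S = "\<lambda>w. {\<alpha>. length \<alpha> = length bs \<and> (\<Sum>i<length bs. (\<alpha> ! i) *s (bs ! i)) = w}"
  \<comment> \<open>A coefficient tuple for \<open>b # bs\<close> splits into a head
    \<open>c\<close> and a tail that must represent \<open>v - c *s b\<close>.\<close>
  have "{\<alpha>. length \<alpha> = length (b # bs) \<and> (\<Sum>i<length (b # bs). (\<alpha> ! i) *s ((b # bs) ! i)) = v}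
      = (\<lambda>(c, \<alpha>). c # \<alpha>) ` (SIGMA c:UNIV. ?S (v - c *s b))" (is "?L = ?R")
  proof (rule Set.set_eqI)
    fix \<beta> :: "'a list"
    show "\<beta> \<in> ?L \<longleftrightarrow> \<beta> \<in> ?R"
      by (cases \<beta>) (auto simp: sum.lessThan_Suc_shift eq_diff_eq add.commute
          image_iff simp del: sum.lessThan_Suc)
  qed
  then have "count (mspan (mset (b # bs))) v = card ?R"
    unfolding count_mspan by (rule arg_cong)
  also have "\<dots> = card (SIGMA c:UNIV. ?S (v - c *s b))"
    by (rule card_image) (auto simp: inj_on_def)
  also have "\<dots> = (\<Sum>c\<in>UNIV. card (?S (v - c *s b)))"
    by (subst card_SigmaI) (auto intro: finite_subset[OF _ finite_tuples[of "length bs"]])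
  also have "\<dots> = (\<Sum>c\<in>UNIV. count (mspan (mset bs)) (v - c *s b))"
    by (simp only: count_mspan)
  finally show ?thesis using bs by simp
qed

text \<open>Translation by \<open>c *s b\<close> preserves \<open>V\<close>, so for \<open>v\<close>
  in \<open>V\<close> each of the \<open>CARD('a)\<close> scalars contributes the old multiplicity,
  and for other \<open>v\<close> none contributes.\<close>

lemma mspan_add_in:
  assumes "vec.subspace V" "mspan B = uniform_mspace V t" "b \<in> V"
  shows "mspan (add_mset b B) = uniform_mspace V (Suc t)"
proof (rule multiset_eqI)
  fix v
  have "v - c *s b \<in> V \<longleftrightarrow> v \<in> V" for c
    using vec.subspace_diff[OF assms(1), of v "c *s b"] vec.subspace_add[OF assms(1), of "v - c *s b" "c *s b"]
      vec.subspace_scale[OF assms(1,3), of c] by auto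
  then show "count (mspan (add_mset b B)) v = count (uniform_mspace V (Suc t)) v"
    by (simp add: count_mspan_add assms(2) count_uniform_mspace)
qed

text \<open>Each \<open>v\<close> in the enlarged span has exactly one scalar \<open>c\<close> with
  \<open>v - c *s b\<close> in \<open>V\<close>, so the sum over scalars has a single nonzero term
  and the multiplicity is unchanged.\<close>

lemma mspan_add_notin:
  assumes V: "vec.subspace V" and B: "mspan B = uniform_mspace V t" and b: "b \<notin> V"
  shows "mspan (add_mset b B) = uniform_mspace (vec.span (insert b V)) t"
proof (rule multiset_eqI)
  fix v
  have span: "v \<in> vec.span (insert b V) \<longleftrightarrow> (\<exists>c. v - c *s b \<in> V)"
    using V by (simp add: vec.span_breakdown_eq vec.span_eq_iff[THEN iffD2])
  \<comment> \<open>Two distinct such scalars would put \<open>(d - c) *s b\<close> into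
    \<open>V\<close>, and dividing by \<open>d - c\<close> would put \<open>b\<close> there.\<close>
  have uniq: "c = d" if "v - c *s b \<in> V" "v - d *s b \<in> V" for c d
  proof (rule ccontr)
    assume "c \<noteq> d"
    have "(d - c) *s b \<in> V"
      using vec.subspace_diff[OF V that] by (simp add: vec.scale_left_diff_distrib)
    then have "inverse (d - c) *s ((d - c) *s b) \<in> V"
      by (rule vec.subspace_scale[OF V])
    moreover have "inverse (d - c) *s ((d - c) *s b) = b"
      unfolding vec.scale_scale using \<open>c \<noteq> d\<close> by (simp del: vec.scale_left_diff_distrib)
    ultimately show False using b by simp
  qed
  show "count (mspan (add_mset b B)) v = count (uniform_mspace (vec.span (insert b V)) t) v"
  proof (cases "\<exists>c. v - c *s b \<in> V")
    case True
    then obtain c where c: "v - c *s b \<in> V" by blast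
    then have "v - d *s b \<in> V \<longleftrightarrow> d = c" for d using uniq by blast
    then show ?thesis
      using True by (simp add: count_mspan_add B count_uniform_mspace span)
  next
    case False
    then show ?thesis
      by (simp add: count_mspan_add B count_uniform_mspace span)
  qed
qed

lemma mspan_uniform: "\<exists>V t. vec.subspace V \<and> mspan B = uniform_mspace V t"
proof (induction B)
  case empty
  have "mspan {#} = uniform_mspace {0} 0"
    by (simp add: mspan_empty uniform_mspace_def)
  then show ?case using vec.subspace_single_0 by blast
next
  case (add b B)
  then obtain V t where V: "vec.subspace V" and B: "mspan B = uniform_mspace V t"
    by blast
  show ?case
    using mspan_add_in[OF V B, of b] mspan_add_notin[OF V B, of b] V vec.subspace_span
    by (cases "b \<in> V") blast+
qed

text \<open>Each new vector lies outside the span of the earlier ones, so every insertion enlarges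
  the subspace and the exponent stays 0.\<close>

lemma mspan_independent:
  assumes "finite S" "vec.independent S"
  shows "mspan (mset_set S) = uniform_mspace (vec.span S) 0"
  using assms
proof (induction S)
  case empty
  then show ?case by (simp add: mspan_empty uniform_mspace_def)
next
  case (insert b S)
  then have "b \<notin> vec.span S" "vec.independent S"
    by (auto simp: vec.independent_insert)
  moreover have "vec.span (insert b (vec.span S)) = vec.span (insert b S)"
    by (simp add: vec.span_insert vec.span_span)
  ultimately show ?case
    using insert mspan_add_notin[OF vec.subspace_span, of "mset_set S" S 0 b] by simp
qed

text \<open>A basis of \<open>V\<close> realises exponent 0. Each extra copy of the zero vector as a
  generator raises the exponent by one and keeps \<open>V\<close>.\<close>

lemma uniform_mspace_in_multispaces:
  assumes "vec.subspace V"
  shows "uniform_mspace V t \<in> multispaces"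
proof -
  have "\<exists>B. mspan B = uniform_mspace V t"
  proof (induction t)
    case 0
    obtain S where S: "S \<subseteq> V" "vec.independent S" "V \<subseteq> vec.span S"
      using vec.maximal_independent_subset by blast
    then have "vec.span S = V"
      using assms vec.span_minimal by blast
    then show ?case
      using mspan_independent[OF _ S(2)] by auto
  next
    case (Suc t)
    then show ?case
      using mspan_add_in[OF assms _ vec.subspace_0[OF assms]] by blast
  qed
  then show ?thesis by (auto simp: multispaces_def intro: sym)
qed

lemma multispaces_eq: "multispaces = {uniform_mspace V t | V t. vec.subspace V}"
  using mspan_uniform uniform_mspace_in_multispaces by (fastforce simp: multispaces_def)

section \<open>The modular law for subspaces\<close>

abbreviation subspace_sum ::
    "('a::{field,finite} ^ 'n::finite) set \<Rightarrow> ('a ^ 'n) set \<Rightarrow> ('a ^ 'n) set" where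
  "subspace_sum V W \<equiv> vec.span (V \<union> W)"

lemma mem_subspace_sum:
  assumes "vec.subspace V" "vec.subspace W"
  shows "v \<in> subspace_sum V W \<longleftrightarrow> (\<exists>x\<in>V. \<exists>y\<in>W. v = x + y)"
  using assms by (auto simp: vec.span_Un vec.span_eq_iff[THEN iffD2])

lemma subspace_modular:
  assumes "vec.subspace U" "vec.subspace V" "vec.subspace W" "U \<subseteq> V"
  shows "subspace_sum U (W \<inter> V) = subspace_sum U W \<inter> V"
proof (rule Set.set_eqI)
  fix v
  show "v \<in> subspace_sum U (W \<inter> V) \<longleftrightarrow> v \<in> subspace_sum U W \<inter> V"
  proof
    assume "v \<in> subspace_sum U (W \<inter> V)"
    then show "v \<in> subspace_sum U W \<inter> V"
      using assms by (auto simp: mem_subspace_sum vec.subspace_inter intro: vec.subspace_add)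
  next
    assume v: "v \<in> subspace_sum U W \<inter> V"
    then obtain x y where xy: "x \<in> U" "y \<in> W" "v = x + y"
      using assms by (auto simp: mem_subspace_sum)
    \<comment> \<open>Here \<open>y = v - x\<close>, and \<open>x\<close> lies in \<open>V\<close>
      because \<open>U\<close> does.\<close>
    then have "y \<in> V"
      using v assms vec.subspace_diff[of V v x] by auto
    with xy show "v \<in> subspace_sum U (W \<inter> V)"
      using assms by (auto simp: mem_subspace_sum vec.subspace_inter)
  qed
qed

section \<open>Joins and meets of multispaces\<close>

lemma multispace_poset_simps [simp]:
  "carrier multispace_poset = multispaces"
  "le multispace_poset = (\<subseteq>#)"
  "eq multispace_poset = (=)"
  by (simp_all add: multispace_poset_def)

lemma lless_multispace_poset [simp]:
  "x \<sqsubset>\<^bsub>multispace_poset\<^esub> y \<longleftrightarrow> x \<subset># y"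
  by (simp add: lless_def subset_mset.less_le)

text \<open>Upper bounds are described by pairs: a subspace contains \<open>V\<close> and
  \<open>W\<close> iff it contains the span of their union, and an exponent bounds \<open>s\<close>
  and \<open>t\<close> iff it bounds their maximum.\<close>

lemma least_Upper_uniform_mspace:
  assumes "vec.subspace V" "vec.subspace W"
  shows "least multispace_poset (uniform_mspace (subspace_sum V W) (max s t))
    (Upper multispace_poset {uniform_mspace V s, uniform_mspace W t})"
proof -
  have "Upper multispace_poset {uniform_mspace V s, uniform_mspace W t}
      = {uniform_mspace U r | U r. vec.subspace U \<and> subspace_sum V W \<subseteq> U \<and> max s t \<le> r}"
    (is "?Up = ?M")
  proof -
    have "?Up = {u \<in> multispaces. uniform_mspace V s \<subseteq># u \<and> uniform_mspace W t \<subseteq># u}"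
      using assms uniform_mspace_in_multispaces by (auto simp: Upper_def)
    also have "\<dots> = {uniform_mspace U r | U r. vec.subspace U \<and> V \<subseteq> U \<and> s \<le> r \<and> W \<subseteq> U \<and> t \<le> r}"
      using assms by (auto simp: multispaces_eq uniform_mspace_subseteq_iff) blast
    also have "\<dots> = ?M"
    proof -
      have "V \<subseteq> U \<and> W \<subseteq> U \<longleftrightarrow> subspace_sum V W \<subseteq> U" if "vec.subspace U" for U
        using that vec.span_minimal[of "V \<union> W" U] vec.span_superset[of "V \<union> W"] by blast
      then show ?thesis by (metis (no_types, lifting) max.bounded_iff)
    qed
    finally show ?thesis .
  qed
  moreover have "uniform_mspace (subspace_sum V W) (max s t) \<in> ?M"
    by (intro CollectI exI conjI) (rule refl vec.subspace_span order_refl)+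
  moreover have "uniform_mspace (subspace_sum V W) (max s t) \<subseteq># u" if "u \<in> ?M" for u
    using that by (auto simp: uniform_mspace_subseteq_iff)
  moreover have "?M \<subseteq> multispaces"
    using uniform_mspace_in_multispaces by blast
  ultimately show ?thesis
    by (simp only: least_def multispace_poset_simps) blast
qed

lemma greatest_Lower_uniform_mspace:
  assumes "vec.subspace V" "vec.subspace W"
  shows "greatest multispace_poset (uniform_mspace (V \<inter> W) (min s t))
    (Lower multispace_poset {uniform_mspace V s, uniform_mspace W t})"
proof -
  let ?M = "{uniform_mspace U r | U r. vec.subspace U \<and> U \<subseteq> V \<inter> W \<and> r \<le> min s t}"
  have "Lower multispace_poset {uniform_mspace V s, uniform_mspace W t}
      = {u \<in> multispaces. u \<subseteq># uniform_mspace V s \<and> u \<subseteq># uniform_mspace W t}"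
    using assms uniform_mspace_in_multispaces by (auto simp: Lower_def)
  also have "\<dots> = ?M"
    by (auto simp: multispaces_eq uniform_mspace_subseteq_iff) blast
  finally have "Lower multispace_poset {uniform_mspace V s, uniform_mspace W t} = ?M" .
  moreover have "uniform_mspace (V \<inter> W) (min s t) \<in> ?M"
    by (intro CollectI exI conjI) (rule refl vec.subspace_inter[OF assms] order_refl)+
  moreover have "u \<subseteq># uniform_mspace (V \<inter> W) (min s t)" if "u \<in> ?M" for u
    using that by (auto simp: uniform_mspace_subseteq_iff)
  moreover have "?M \<subseteq> multispaces"
    using uniform_mspace_in_multispaces by blast
  ultimately show ?thesis
    by (simp only: greatest_def multispace_poset_simps) blast
qed

interpretation multispace: Lattice.lattice
  "multispace_poset :: ('a::{field,finite} ^ 'n::finite) multiset gorder"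
proof unfold_locales
  fix x y :: "('a ^ 'n) multiset"
  assume "x \<in> carrier multispace_poset" "y \<in> carrier multispace_poset"
  then obtain V s W t where "vec.subspace V" "x = uniform_mspace V s"
    "vec.subspace W" "y = uniform_mspace W t"
    by (auto simp: multispaces_eq)
  then show "\<exists>u. least multispace_poset u (Upper multispace_poset {x, y})"
    and "\<exists>l. greatest multispace_poset l (Lower multispace_poset {x, y})"
    using least_Upper_uniform_mspace[of V W s t] greatest_Lower_uniform_mspace[of V W s t] by blast+
qed (simp_all add: subset_mset.order_trans)

text \<open>Least upper bounds are unique here, so the join is the one already exhibited.\<close>

lemma join_uniform_mspace:
  assumes "vec.subspace V" "vec.subspace W"
  shows "uniform_mspace V s \<squnion>\<^bsub>multispace_poset\<^esub> uniform_mspace W t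
    = uniform_mspace (subspace_sum V W) (max s t)"
proof (rule multispace.joinI)
  fix u
  assume "least multispace_poset u (Upper multispace_poset {uniform_mspace V s, uniform_mspace W t})"
  then show "u = uniform_mspace (subspace_sum V W) (max s t)"
    using multispace.weak_least_unique[OF _ least_Upper_uniform_mspace[OF assms, of s t]] by simp
qed (simp_all add: assms uniform_mspace_in_multispaces)

lemma meet_uniform_mspace:
  assumes "vec.subspace V" "vec.subspace W"
  shows "uniform_mspace V s \<sqinter>\<^bsub>multispace_poset\<^esub> uniform_mspace W t
    = uniform_mspace (V \<inter> W) (min s t)"
proof (rule multispace.meetI)
  fix u
  assume "greatest multispace_poset u (Lower multispace_poset {uniform_mspace V s, uniform_mspace W t})"
  then show "u = uniform_mspace (V \<inter> W) (min s t)"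
    using multispace.weak_greatest_unique[OF _ greatest_Lower_uniform_mspace[OF assms, of s t]] by simp
qed (simp_all add: assms uniform_mspace_in_multispaces)

section \<open>Covers, grading and modularity\<close>

lemma covers_uniform_mspace:
  fixes V W :: "('a::{field,finite} ^ 'n::finite) set"
  assumes V: "vec.subspace V" and W: "vec.subspace W"
    and cov: "covers multispace_poset (uniform_mspace W t) (uniform_mspace V s)"
  shows "vec.dim W + t = vec.dim V + s + 1"
proof -
  have less: "V \<subseteq> W" "s \<le> t" "V \<noteq> W \<or> s \<noteq> t"
    using cov V W by (auto simp: covers_def subset_mset.less_le uniform_mspace_subseteq_iff
        uniform_mspace_eq_iff)
  have between: "U = V \<and> r = s \<or> U = W \<and> r = t"
    if "vec.subspace U" "V \<subseteq> U" "U \<subseteq> W" "s \<le> r" "r \<le> t" for U r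
  proof (rule ccontr)
    assume "\<not> ?thesis"
    with that V W have "uniform_mspace V s \<subset># uniform_mspace U r"
      "uniform_mspace U r \<subset># uniform_mspace W t"
      by (auto simp: subset_mset.less_le uniform_mspace_subseteq_iff uniform_mspace_eq_iff)
    with cov uniform_mspace_in_multispaces[OF that(1)] show False
      by (auto simp: covers_def)
  qed
  show ?thesis
  proof (cases "V = W")
    case True
    \<comment> \<open>Now \<open>s < t\<close>, so \<open>(V, Suc s)\<close> lies in the interval
      and is not its lower end; hence \<open>t = Suc s\<close>.\<close>
    with less between[of V "Suc s"] V show ?thesis by auto
  next
    case False
    have st: "s = t"
      \<comment> \<open>The pair \<open>(V, t)\<close> is not the upper end since \<open>V\<close>
        and \<open>W\<close> differ, so it is the lower one.\<close>
      using between[of V t] False V less by auto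
    obtain w where w: "w \<in> W" "w \<notin> V"
      using False less(1) by blast
    \<comment> \<open>Adjoining one vector of \<open>W\<close> outside \<open>V\<close> must already
      give \<open>W\<close>, so the dimension grows by exactly one.\<close>
    let ?U = "vec.span (insert w V)"
    have "V \<subseteq> ?U" "w \<in> ?U"
      by (auto intro: vec.span_base)
    moreover have "?U \<subseteq> W"
      using w less(1) W by (intro vec.span_minimal) auto
    ultimately have "?U = W"
      using between[of ?U s] w less(2) by auto
    moreover have "vec.dim ?U = vec.dim V + 1"
      using w V by (simp add: vec.dim_insert vec.span_eq_iff[THEN iffD2])
    ultimately show ?thesis using st by simp
  qed
qed

theorem proposition2p6:
  shows "graded_lattice (multispace_poset :: ('a::{field,finite} ^ 'n::finite) multiset gorder)
       \<and> modular_lattice (multispace_poset :: ('a ^ 'n) multiset gorder)"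
proof
  let ?P = "multispace_poset :: ('a ^ 'n) multiset gorder"
  show "graded_lattice ?P"
  proof unfold_locales
    \<comment> \<open>The pair is recovered from the multiset: the subspace is the support, and the
      exponent is read off at 0, where it is unique because \<open>CARD('a)\<close> > 1.\<close>
    define r where "r X = int (vec.dim (set_mset X) + (THE t. count X 0 = CARD('a) ^ t))"
      for X :: "('a ^ 'n) multiset"
    have r: "r (uniform_mspace V t) = int (vec.dim V + t)" if "vec.subspace V" for V t
    proof -
      have "(THE u. CARD('a) ^ t = CARD('a) ^ u) = t"
        using card_field_gt_1[where 'a = 'a] by (intro the_equality) auto
      then show ?thesis
        using vec.subspace_0[OF that]
        by (simp add: r_def count_uniform_mspace set_uniform_mspace)
    qed
    have "r y = r x + 1" if x: "x \<in> multispaces" and y: "y \<in> multispaces" and cov: "covers ?P y x" for x y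
    proof -
      obtain V s W t where V: "vec.subspace V" "x = uniform_mspace V s"
        and W: "vec.subspace W" "y = uniform_mspace W t"
        using x y by (auto simp: multispaces_eq)
      then show ?thesis
        using covers_uniform_mspace[OF V(1) W(1)] cov by (simp add: r)
    qed
    then show "\<exists>r :: ('a ^ 'n) multiset \<Rightarrow> int. \<forall>x\<in>carrier ?P. \<forall>y\<in>carrier ?P.
        covers ?P y x \<longrightarrow> r y = r x + 1"
      by auto
  qed
  show "modular_lattice ?P"
  proof unfold_locales
    fix x y z
    assume "x \<in> carrier ?P" "y \<in> carrier ?P" "z \<in> carrier ?P" and less: "x \<sqsubset>\<^bsub>?P\<^esub> y"
    then obtain U r V s W t
      where U: "vec.subspace U" and x: "x = uniform_mspace U r"
        and V: "vec.subspace V" and y: "y = uniform_mspace V s"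
        and W: "vec.subspace W" and z: "z = uniform_mspace W t"
      by (auto simp: multispaces_eq)
    have "U \<subseteq> V" "r \<le> s"
      using less U by (auto simp: x y subset_mset.less_le uniform_mspace_subseteq_iff)
    \<comment> \<open>The modular law is checked in each factor; on exponents it holds because
      \<open>r \<le> s\<close>.\<close>
    then have "subspace_sum U (W \<inter> V) = subspace_sum U W \<inter> V"
      and "max r (min t s) = min (max r t) s"
      using subspace_modular[OF U V W] by auto
    then show "x \<squnion>\<^bsub>?P\<^esub> (z \<sqinter>\<^bsub>?P\<^esub> y) = (x \<squnion>\<^bsub>?P\<^esub> z) \<sqinter>\<^bsub>?P\<^esub> y"
      using U V W vec.subspace_inter[OF W V]
      by (simp add: x y z join_uniform_mspace meet_uniform_mspace)
  qed
qed

end
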